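(* Let $L$ be an axiomatic extension of $\mathrm{MTL}$. Then $L$ enjoys the pseudo-relevance property if and only if $L$ is an extension of $\mathrm{SMTL}$.
   Context: Monoidal t-norm based logic $\mathrm{MTL}$: formulas are built from a denumerable set of propositional variables with the binary connectives $\&,\land,\to$ and the constant $\bot$. Derived connectives: $\neg\varphi:=\varphi\to\bot$, $\varphi\vee\psi:=((\varphi\to\psi)\to\psi)\land((\psi\to\varphi)\to\varphi)$. Axiom schemata: $(\varphi\to\psi)\to((\psi\to\chi)\to(\varphi\to\chi))$; $(\varphi\&\psi)\to\varphi$; $(\varphi\&\psi)\to(\psi\&\varphi)$; $(\varphi\land\psi)\to\varphi$; $(\varphi\land\psi)\to(\psi\land\varphi)$; $(\varphi\&(\varphi\to\psi))\to(\psi\land\varphi)$; $(\varphi\to(\psi\to\chi))\to((\varphi\&\psi)\to\chi)$; $((\varphi\&\psi)\to\chi)\to(\varphi\to(\psi\to\chi))$; $((\varphi\to\psi)\to\chi)\to(((\psi\to\varphi)\to\chi)\to\chi)$; $\bot\to\varphi$. The only rule is modus ponens. An axiomatic extension $L$ of $\mathrm{MTL}$ is a logic obtained from $\mathrm{MTL}$ by adding axiom schemata; $\vdash_L$ denotes provability in $L$. $\mathrm{SMTL}$ is $\mathrm{MTL}$ plus the axiom schema $\neg(\varphi\land\neg\varphi)$; $L$ is an extension of $\mathrm{SMTL}$ if every theorem of $\mathrm{SMTL}$ is a theorem of $L$. $L$ has the pseudo-relevance property if for all formulas $\varphi,\psi$ with no variables in common, $\vdash_L\varphi\to\psi$ implies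 $\vdash_L\neg\varphi$ or $\vdash_L\psi$. *)

theory Defs
  imports Main
begin

datatype form =
    Var nat
  | Bot ("\<^bold>\<bottom>")
  | Strong form form (infixr "\<^bold>&" 75)
  | And form form (infixr "\<^bold>\<and>" 70)
  | Imp form form (infixr "\<^bold>\<rightarrow>" 60)

definition Neg :: "form \<Rightarrow> form" ("\<^bold>\<not> _" [80] 80) where
  "\<^bold>\<not> \<phi> = \<phi> \<^bold>\<rightarrow> \<^bold>\<bottom>"

primrec vars :: "form \<Rightarrow> nat set" where
  "vars (Var n) = {n}"
| "vars \<^bold>\<bottom> = {}"
| "vars (\<phi> \<^bold>& \<psi>) = vars \<phi> \<union> vars \<psi>"
| "vars (\<phi> \<^bold>\<and> \<psi>) = vars \<phi> \<union> vars \<psi>"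
| "vars (\<phi> \<^bold>\<rightarrow> \<psi>) = vars \<phi> \<union> vars \<psi>"

primrec subst_form :: "(nat \<Rightarrow> form) \<Rightarrow> form \<Rightarrow> form" where
  "subst_form \<sigma> (Var n) = \<sigma> n"
| "subst_form \<sigma> \<^bold>\<bottom> = \<^bold>\<bottom>"
| "subst_form \<sigma> (\<phi> \<^bold>& \<psi>) = subst_form \<sigma> \<phi> \<^bold>& subst_form \<sigma> \<psi>"
| "subst_form \<sigma> (\<phi> \<^bold>\<and> \<psi>) = subst_form \<sigma> \<phi> \<^bold>\<and> subst_form \<sigma> \<psi>"
| "subst_form \<sigma> (\<phi> \<^bold>\<rightarrow> \<psi>) = subst_form \<sigma> \<phi> \<^bold>\<rightarrow> subst_form \<sigma> \<psi>"

inductive MTL_axiom :: "form \<Rightarrow> bool" where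
  "MTL_axiom ((\<phi> \<^bold>\<rightarrow> \<psi>) \<^bold>\<rightarrow> ((\<psi> \<^bold>\<rightarrow> \<chi>) \<^bold>\<rightarrow> (\<phi> \<^bold>\<rightarrow> \<chi>)))"
| "MTL_axiom ((\<phi> \<^bold>& \<psi>) \<^bold>\<rightarrow> \<phi>)"
| "MTL_axiom ((\<phi> \<^bold>& \<psi>) \<^bold>\<rightarrow> (\<psi> \<^bold>& \<phi>))"
| "MTL_axiom ((\<phi> \<^bold>\<and> \<psi>) \<^bold>\<rightarrow> \<phi>)"
| "MTL_axiom ((\<phi> \<^bold>\<and> \<psi>) \<^bold>\<rightarrow> (\<psi> \<^bold>\<and> \<phi>))"
| "MTL_axiom ((\<phi> \<^bold>& (\<phi> \<^bold>\<rightarrow> \<psi>)) \<^bold>\<rightarrow> (\<psi> \<^bold>\<and> \<phi>))"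
| "MTL_axiom ((\<phi> \<^bold>\<rightarrow> (\<psi> \<^bold>\<rightarrow> \<chi>)) \<^bold>\<rightarrow> ((\<phi> \<^bold>& \<psi>) \<^bold>\<rightarrow> \<chi>))"
| "MTL_axiom (((\<phi> \<^bold>& \<psi>) \<^bold>\<rightarrow> \<chi>) \<^bold>\<rightarrow> (\<phi> \<^bold>\<rightarrow> (\<psi> \<^bold>\<rightarrow> \<chi>)))"
| "MTL_axiom (((\<phi> \<^bold>\<rightarrow> \<psi>) \<^bold>\<rightarrow> \<chi>) \<^bold>\<rightarrow> (((\<psi> \<^bold>\<rightarrow> \<phi>) \<^bold>\<rightarrow> \<chi>) \<^bold>\<rightarrow> \<chi>))"
| "MTL_axiom (\<^bold>\<bottom> \<^bold>\<rightarrow> \<phi>)"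

text \<open>
  An axiomatic extension of MTL is presented by the (arbitrary, possibly infinite) set \<open>L\<close>
  of axiom schemata added to MTL. A schema is represented by a formula whose variables play the
  role of metavariables; its instances are all its substitution instances. MTL itself is
  presented by the empty set.
\<close>

inductive provable :: "form set \<Rightarrow> form \<Rightarrow> bool" ("\<turnstile>\<^bsub>_\<^esub> _" [0, 51] 50) for L where
  mtl: "MTL_axiom \<phi> \<Longrightarrow> \<turnstile>\<^bsub>L\<^esub> \<phi>"
| schema: "\<alpha> \<in> L \<Longrightarrow> \<turnstile>\<^bsub>L\<^esub> subst_form \<sigma> \<alpha>"
| mp: "\<turnstile>\<^bsub>L\<^esub> \<phi> \<Longrightarrow> \<turnstile>\<^bsub>L\<^esub> \<phi> \<^bold>\<rightarrow> \<psi> \<Longrightarrow> \<turnstile>\<^bsub>L\<^esub> \<psi>"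

definition SMTL :: "form set" where
  "SMTL = {\<^bold>\<not> (Var 0 \<^bold>\<and> \<^bold>\<not> Var 0)}"

definition extension_of :: "form set \<Rightarrow> form set \<Rightarrow> bool" where
  "extension_of L L' \<longleftrightarrow> (\<forall>\<phi>. \<turnstile>\<^bsub>L'\<^esub> \<phi> \<longrightarrow> \<turnstile>\<^bsub>L\<^esub> \<phi>)"

definition pseudo_relevance :: "form set \<Rightarrow> bool" where
  "pseudo_relevance L \<longleftrightarrow>
     (\<forall>\<phi> \<psi>. vars \<phi> \<inter> vars \<psi> = {} \<longrightarrow> \<turnstile>\<^bsub>L\<^esub> \<phi> \<^bold>\<rightarrow> \<psi> \<longrightarrow> \<turnstile>\<^bsub>L\<^esub> \<^bold>\<not> \<phi> \<or> \<turnstile>\<^bsub>L\<^esub> \<psi>)"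

end

theory Submission
  imports Defs
begin

text \<open>
  If pseudo-relevance holds, apply it to \<open>a \<rightarrow> \<not> b\<close>, where \<open>a\<close> and \<open>b\<close> are the
  instances of \<open>p \<and> \<not> p\<close> at two distinct variables. It is a theorem of MTL: by prelinearity
  \<open>a & b\<close> lies below \<open>a & a\<close> or \<open>b & b\<close>, and both are inconsistent. Either disjunct
  \<open>\<not> a\<close>, \<open>\<not> b\<close> is the SMTL axiom up to renaming.

  Conversely let \<open>\<phi> \<rightarrow> \<psi>\<close> be provable in an extension of SMTL, with no shared variables. If a classical
  valuation satisfies \<open>\<phi>\<close>, substituting the corresponding constants for the variables of
  \<open>\<phi>\<close> makes \<open>\<phi>\<close> provable and leaves \<open>\<psi>\<close> unchanged, so \<open>\<psi>\<close> is provable. Otherwise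
  \<open>\<phi>\<close> is classically unsatisfiable and a Kalmar-style argument gives \<open>\<not> \<phi>\<close> (Glivenko):
  over SMTL the formulas \<open>\<not> p\<close> and \<open>\<not> \<not> p\<close> are idempotent for \<open>&\<close> and exhaust all cases.
\<close>

subsection \<open>Derived rules of MTL\<close>

lemma imp_trans:
  assumes "\<turnstile>\<^bsub>L\<^esub> \<phi> \<^bold>\<rightarrow> \<psi>" "\<turnstile>\<^bsub>L\<^esub> \<psi> \<^bold>\<rightarrow> \<chi>"
  shows "\<turnstile>\<^bsub>L\<^esub> \<phi> \<^bold>\<rightarrow> \<chi>"
  by (rule mp[OF assms(2) mp[OF assms(1) mtl[OF MTL_axiom.intros(1)]]])

lemma strong_imp_left: "\<turnstile>\<^bsub>L\<^esub> \<phi> \<^bold>& \<psi> \<^bold>\<rightarrow> \<phi>"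
  by (intro mtl MTL_axiom.intros)

lemma strong_commute: "\<turnstile>\<^bsub>L\<^esub> \<phi> \<^bold>& \<psi> \<^bold>\<rightarrow> \<psi> \<^bold>& \<phi>"
  by (intro mtl MTL_axiom.intros)

lemma strong_imp_right: "\<turnstile>\<^bsub>L\<^esub> \<phi> \<^bold>& \<psi> \<^bold>\<rightarrow> \<psi>"
  by (rule imp_trans[OF strong_commute strong_imp_left])

lemma and_imp_left: "\<turnstile>\<^bsub>L\<^esub> \<phi> \<^bold>\<and> \<psi> \<^bold>\<rightarrow> \<phi>"
  by (intro mtl MTL_axiom.intros)

lemma and_imp_right: "\<turnstile>\<^bsub>L\<^esub> \<phi> \<^bold>\<and> \<psi> \<^bold>\<rightarrow> \<psi>"
  by (rule imp_trans[OF mtl[OF MTL_axiom.intros(5)] and_imp_left])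

lemma divisibility: "\<turnstile>\<^bsub>L\<^esub> \<phi> \<^bold>& (\<phi> \<^bold>\<rightarrow> \<psi>) \<^bold>\<rightarrow> \<psi> \<^bold>\<and> \<phi>"
  by (intro mtl MTL_axiom.intros)

lemma bot_imp: "\<turnstile>\<^bsub>L\<^esub> \<^bold>\<bottom> \<^bold>\<rightarrow> \<phi>"
  by (intro mtl MTL_axiom.intros)

text \<open>The two currying axioms at the level of provability. Most facts about \<open>&\<close>
  below come from moving factors across the implication with it.\<close>

lemma residuation: "(\<turnstile>\<^bsub>L\<^esub> \<phi> \<^bold>& \<psi> \<^bold>\<rightarrow> \<chi>) \<longleftrightarrow> (\<turnstile>\<^bsub>L\<^esub> \<phi> \<^bold>\<rightarrow> (\<psi> \<^bold>\<rightarrow> \<chi>))"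
  using mp[OF _ mtl[OF MTL_axiom.intros(7)]] mp[OF _ mtl[OF MTL_axiom.intros(8)]] by blast

lemma imp_exchange: "\<turnstile>\<^bsub>L\<^esub> \<phi> \<^bold>\<rightarrow> (\<psi> \<^bold>\<rightarrow> \<chi>) \<Longrightarrow> \<turnstile>\<^bsub>L\<^esub> \<psi> \<^bold>\<rightarrow> (\<phi> \<^bold>\<rightarrow> \<chi>)"
  unfolding residuation[symmetric] by (rule imp_trans[OF strong_commute])

lemma imp_weaken: "\<turnstile>\<^bsub>L\<^esub> \<phi> \<^bold>\<rightarrow> (\<psi> \<^bold>\<rightarrow> \<phi>)"
  unfolding residuation[symmetric] by (rule strong_imp_left)

lemma imp_refl: "\<turnstile>\<^bsub>L\<^esub> \<phi> \<^bold>\<rightarrow> \<phi>"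
  \<comment> \<open>Exchanging the premises of weakening gives
    \<open>\<psi> \<rightarrow> (\<phi> \<rightarrow> \<phi>)\<close>; the theorem put for
    \<open>\<psi>\<close> is itself an instance of weakening.\<close>
  by (rule mp[OF imp_weaken imp_exchange[OF imp_weaken]])

lemma imp_of_provable: "\<turnstile>\<^bsub>L\<^esub> \<phi> \<Longrightarrow> \<turnstile>\<^bsub>L\<^esub> \<psi> \<^bold>\<rightarrow> \<phi>"
  by (rule mp[OF _ imp_weaken])

lemma modus_ponens_imp: "\<turnstile>\<^bsub>L\<^esub> \<phi> \<^bold>& (\<phi> \<^bold>\<rightarrow> \<psi>) \<^bold>\<rightarrow> \<psi>"
  by (rule imp_trans[OF divisibility and_imp_left])

lemma strong_mono:
  assumes "\<turnstile>\<^bsub>L\<^esub> \<phi> \<^bold>\<rightarrow> \<phi>'" "\<turnstile>\<^bsub>L\<^esub> \<psi> \<^bold>\<rightarrow> \<psi>'"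
  shows "\<turnstile>\<^bsub>L\<^esub> \<phi> \<^bold>& \<psi> \<^bold>\<rightarrow> \<phi>' \<^bold>& \<psi>'"
proof -
  \<comment> \<open>Replacing the left factor is enough; commutativity transfers it to the right
    factor.\<close>
  have left: "\<turnstile>\<^bsub>L\<^esub> \<alpha> \<^bold>& \<gamma> \<^bold>\<rightarrow> \<beta> \<^bold>& \<gamma>" if "\<turnstile>\<^bsub>L\<^esub> \<alpha> \<^bold>\<rightarrow> \<beta>" for \<alpha> \<beta> \<gamma>
    unfolding residuation
    by (rule imp_trans[OF that]) (simp add: imp_refl flip: residuation)
  show ?thesis
    using left[OF assms(1)]
      imp_trans[OF strong_commute imp_trans[OF left[OF assms(2)] strong_commute]]
    by (rule imp_trans)
qed

text \<open>Both bracketings curry to the same nested implication, so reflexivity of one product,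
  fully curried, can be uncurried into the other.\<close>

lemma strong_assoc: "\<turnstile>\<^bsub>L\<^esub> (\<phi> \<^bold>& \<psi>) \<^bold>& \<chi> \<^bold>\<rightarrow> \<phi> \<^bold>& (\<psi> \<^bold>& \<chi>)"
proof -
  have "\<turnstile>\<^bsub>L\<^esub> \<phi> \<^bold>\<rightarrow> (\<psi> \<^bold>& \<chi> \<^bold>\<rightarrow> \<phi> \<^bold>& (\<psi> \<^bold>& \<chi>))"
    by (simp add: imp_refl flip: residuation)
  then have "\<turnstile>\<^bsub>L\<^esub> \<phi> \<^bold>\<rightarrow> (\<psi> \<^bold>\<rightarrow> (\<chi> \<^bold>\<rightarrow> \<phi> \<^bold>& (\<psi> \<^bold>& \<chi>)))"
    using mtl[OF MTL_axiom.intros(8)] by (rule imp_trans)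
  then show ?thesis
    unfolding residuation .
qed

lemma strong_assoc_sym: "\<turnstile>\<^bsub>L\<^esub> \<phi> \<^bold>& (\<psi> \<^bold>& \<chi>) \<^bold>\<rightarrow> (\<phi> \<^bold>& \<psi>) \<^bold>& \<chi>"
proof -
  have "\<turnstile>\<^bsub>L\<^esub> \<phi> \<^bold>\<rightarrow> (\<psi> \<^bold>\<rightarrow> (\<chi> \<^bold>\<rightarrow> (\<phi> \<^bold>& \<psi>) \<^bold>& \<chi>))"
    by (simp add: imp_refl flip: residuation)
  then show ?thesis
    unfolding residuation by (rule imp_trans[OF _ mtl[OF MTL_axiom.intros(7)]])
qed

text \<open>Reassociation makes the two middle factors adjacent, where they can be swapped. This is
  what makes a product of idempotents idempotent.\<close>

lemma strong_interchange:
  "\<turnstile>\<^bsub>L\<^esub> (\<phi> \<^bold>& \<phi>') \<^bold>& (\<psi> \<^bold>& \<psi>') \<^bold>\<rightarrow> (\<phi> \<^bold>& \<psi>) \<^bold>& (\<phi>' \<^bold>& \<psi>')"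
proof -
  have "\<turnstile>\<^bsub>L\<^esub> \<phi>' \<^bold>& (\<psi> \<^bold>& \<psi>') \<^bold>\<rightarrow> \<psi> \<^bold>& (\<phi>' \<^bold>& \<psi>')"
    using strong_assoc_sym imp_trans[OF strong_mono[OF strong_commute imp_refl] strong_assoc]
    by (rule imp_trans)
  then have "\<turnstile>\<^bsub>L\<^esub> \<phi> \<^bold>& (\<phi>' \<^bold>& (\<psi> \<^bold>& \<psi>')) \<^bold>\<rightarrow> \<phi> \<^bold>& (\<psi> \<^bold>& (\<phi>' \<^bold>& \<psi>'))"
    by (rule strong_mono[OF imp_refl])
  then show ?thesis
    by (rule imp_trans[OF strong_assoc imp_trans[OF _ strong_assoc_sym]])
qed

lemma imp_antimono:
  assumes "\<turnstile>\<^bsub>L\<^esub> \<phi> \<^bold>\<rightarrow> \<psi>"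
  shows "\<turnstile>\<^bsub>L\<^esub> (\<psi> \<^bold>\<rightarrow> \<chi>) \<^bold>\<rightarrow> (\<phi> \<^bold>\<rightarrow> \<chi>)"
  by (rule mp[OF assms mtl[OF MTL_axiom.intros(1)]])

text \<open>Axiom 9 as a rule: proof by cases on which of two formulas implies the other.\<close>

lemma prelinearity:
  assumes "\<turnstile>\<^bsub>L\<^esub> (\<phi> \<^bold>\<rightarrow> \<psi>) \<^bold>\<rightarrow> \<chi>" "\<turnstile>\<^bsub>L\<^esub> (\<psi> \<^bold>\<rightarrow> \<phi>) \<^bold>\<rightarrow> \<chi>"
  shows "\<turnstile>\<^bsub>L\<^esub> \<chi>"
  by (rule mp[OF assms(2) mp[OF assms(1) mtl[OF MTL_axiom.intros(9)]]])

lemma neg_antimono: "\<turnstile>\<^bsub>L\<^esub> \<phi> \<^bold>\<rightarrow> \<psi> \<Longrightarrow> \<turnstile>\<^bsub>L\<^esub> \<^bold>\<not> \<psi> \<^bold>\<rightarrow> \<^bold>\<not> \<phi>"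
  unfolding Neg_def by (rule imp_antimono)

lemma contraposition: "\<turnstile>\<^bsub>L\<^esub> (\<phi> \<^bold>\<rightarrow> \<psi>) \<^bold>\<rightarrow> (\<^bold>\<not> \<psi> \<^bold>\<rightarrow> \<^bold>\<not> \<phi>)"
  unfolding Neg_def by (intro mtl MTL_axiom.intros)

lemma neg_imp_residuation: "(\<turnstile>\<^bsub>L\<^esub> \<phi> \<^bold>& \<psi> \<^bold>\<rightarrow> \<^bold>\<bottom>) \<longleftrightarrow> (\<turnstile>\<^bsub>L\<^esub> \<phi> \<^bold>\<rightarrow> \<^bold>\<not> \<psi>)"
  unfolding Neg_def by (rule residuation)

lemma imp_not_not: "\<turnstile>\<^bsub>L\<^esub> \<phi> \<^bold>\<rightarrow> \<^bold>\<not> \<^bold>\<not> \<phi>"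
  using modus_ponens_imp[of L \<phi> "\<^bold>\<bottom>"] unfolding Neg_def residuation .

lemma not_not_not_imp: "\<turnstile>\<^bsub>L\<^esub> \<^bold>\<not> \<^bold>\<not> \<^bold>\<not> \<phi> \<^bold>\<rightarrow> \<^bold>\<not> \<phi>"
  by (rule neg_antimono[OF imp_not_not])

lemma not_imp_imp: "\<turnstile>\<^bsub>L\<^esub> \<^bold>\<not> \<phi> \<^bold>\<rightarrow> (\<phi> \<^bold>\<rightarrow> \<psi>)"
proof -
  have "\<turnstile>\<^bsub>L\<^esub> \<phi> \<^bold>& \<^bold>\<not> \<phi> \<^bold>\<rightarrow> \<psi>"
    unfolding Neg_def by (rule imp_trans[OF modus_ponens_imp bot_imp])
  then show ?thesis
    unfolding residuation by (rule imp_exchange)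
qed

text \<open>Weakening turns the factor \<open>\<phi>\<close> of \<open>\<psi> & \<phi>\<close> into
  \<open>\<psi> \<rightarrow> \<phi>\<close>, and divisibility then gives the lattice
  conjunction.\<close>

lemma strong_imp_and: "\<turnstile>\<^bsub>L\<^esub> \<phi> \<^bold>& \<psi> \<^bold>\<rightarrow> \<phi> \<^bold>\<and> \<psi>"
proof -
  have "\<turnstile>\<^bsub>L\<^esub> \<psi> \<^bold>& \<phi> \<^bold>\<rightarrow> \<psi> \<^bold>& (\<psi> \<^bold>\<rightarrow> \<phi>)"
    by (rule strong_mono[OF imp_refl imp_weaken])
  then show ?thesis
    by (rule imp_trans[OF strong_commute imp_trans[OF _ divisibility]])
qed

lemma not_strong_imp: "\<turnstile>\<^bsub>L\<^esub> \<^bold>\<not> (\<phi> \<^bold>& \<psi>) \<^bold>\<rightarrow> (\<phi> \<^bold>\<rightarrow> \<^bold>\<not> \<psi>)"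
  unfolding Neg_def by (intro mtl MTL_axiom.intros)

text \<open>From \<open>\<not> (\<phi> & \<psi>)\<close> one gets
  \<open>\<phi> \<rightarrow> \<not> \<psi>\<close>, hence
  \<open>\<not> \<not> \<psi> \<rightarrow> \<not> \<phi>\<close>; a second contraposition, framed
  by two exchanges, gives the claim. It serves the true case of both conjunctions in the Glivenko
  argument.\<close>

lemma not_not_strong: "\<turnstile>\<^bsub>L\<^esub> \<^bold>\<not> \<^bold>\<not> \<phi> \<^bold>\<rightarrow> (\<^bold>\<not> \<^bold>\<not> \<psi> \<^bold>\<rightarrow> \<^bold>\<not> \<^bold>\<not> (\<phi> \<^bold>& \<psi>))"
proof -
  have "\<turnstile>\<^bsub>L\<^esub> \<^bold>\<not> (\<phi> \<^bold>& \<psi>) \<^bold>\<rightarrow> (\<^bold>\<not> \<^bold>\<not> \<psi> \<^bold>\<rightarrow> \<^bold>\<not> \<phi>)"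
    by (rule imp_trans[OF not_strong_imp contraposition])
  then have "\<turnstile>\<^bsub>L\<^esub> \<^bold>\<not> \<^bold>\<not> \<psi> \<^bold>\<rightarrow> (\<^bold>\<not> (\<phi> \<^bold>& \<psi>) \<^bold>\<rightarrow> \<^bold>\<not> \<phi>)"
    by (rule imp_exchange)
  then have "\<turnstile>\<^bsub>L\<^esub> \<^bold>\<not> \<^bold>\<not> \<psi> \<^bold>\<rightarrow> (\<^bold>\<not> \<^bold>\<not> \<phi> \<^bold>\<rightarrow> \<^bold>\<not> \<^bold>\<not> (\<phi> \<^bold>& \<psi>))"
    using contraposition by (rule imp_trans)
  then show ?thesis
    by (rule imp_exchange)
qed

lemma not_imp: "\<turnstile>\<^bsub>L\<^esub> \<^bold>\<not> \<^bold>\<not> \<phi> \<^bold>\<rightarrow> (\<^bold>\<not> \<psi> \<^bold>\<rightarrow> \<^bold>\<not> (\<phi> \<^bold>\<rightarrow> \<psi>))"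
proof -
  have "\<turnstile>\<^bsub>L\<^esub> \<^bold>\<not> \<psi> \<^bold>\<rightarrow> ((\<phi> \<^bold>\<rightarrow> \<psi>) \<^bold>\<rightarrow> \<^bold>\<not> \<phi>)"
    by (rule imp_exchange[OF contraposition])
  then have "\<turnstile>\<^bsub>L\<^esub> \<^bold>\<not> \<psi> \<^bold>\<rightarrow> (\<^bold>\<not> \<^bold>\<not> \<phi> \<^bold>\<rightarrow> \<^bold>\<not> (\<phi> \<^bold>\<rightarrow> \<psi>))"
    using contraposition by (rule imp_trans)
  then show ?thesis
    by (rule imp_exchange)
qed

subsection \<open>Substitution\<close>

lemma MTL_axiom_subst: "MTL_axiom \<phi> \<Longrightarrow> MTL_axiom (subst_form \<sigma> \<phi>)"
  by (induction rule: MTL_axiom.induct) (simp_all add: MTL_axiom.intros)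

lemma subst_subst: "subst_form \<sigma> (subst_form \<tau> \<phi>) = subst_form (subst_form \<sigma> \<circ> \<tau>) \<phi>"
  by (induction \<phi>) simp_all

text \<open>Instances of instances are instances of the same schema, by composing the
  substitutions.\<close>

lemma provable_subst: "\<turnstile>\<^bsub>L\<^esub> \<phi> \<Longrightarrow> \<turnstile>\<^bsub>L\<^esub> subst_form \<sigma> \<phi>"
proof (induction rule: provable.induct)
  case (mtl \<phi>)
  then show ?case
    by (intro provable.mtl MTL_axiom_subst)
next
  case (schema \<alpha> \<tau>)
  then show ?case
    by (simp add: subst_subst provable.schema)
next
  case (mp \<phi> \<psi>)
  then show ?case
    using provable.mp[of L "subst_form \<sigma> \<phi>" "subst_form \<sigma> \<psi>"] by simp
qed

lemma subst_ident: "(\<And>n. n \<in> vars \<phi> \<Longrightarrow> \<sigma> n = Var n) \<Longrightarrow> subst_form \<sigma> \<phi> = \<phi>"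
  by (induction \<phi>) simp_all

lemma subst_Neg [simp]: "subst_form \<sigma> (\<^bold>\<not> \<phi>) = \<^bold>\<not> subst_form \<sigma> \<phi>"
  by (simp add: Neg_def)

lemma vars_Neg [simp]: "vars (\<^bold>\<not> \<phi>) = vars \<phi>"
  by (simp add: Neg_def)

lemma finite_vars: "finite (vars \<phi>)"
  by (induction \<phi>) simp_all

text \<open>SMTL adds a single schema, so induction on SMTL derivations reduces inclusion of
  theorems to the instances of that schema.\<close>

lemma extension_of_SMTL_iff:
  "extension_of L SMTL \<longleftrightarrow> (\<forall>\<phi>. \<turnstile>\<^bsub>L\<^esub> \<^bold>\<not> (\<phi> \<^bold>\<and> \<^bold>\<not> \<phi>))"
proof
  assume ext: "extension_of L SMTL"
  have "\<turnstile>\<^bsub>SMTL\<^esub> subst_form (\<lambda>_. \<phi>) (\<^bold>\<not> (Var 0 \<^bold>\<and> \<^bold>\<not> Var 0))" for \<phi>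
    by (rule provable.schema) (simp add: SMTL_def)
  then show "\<forall>\<phi>. \<turnstile>\<^bsub>L\<^esub> \<^bold>\<not> (\<phi> \<^bold>\<and> \<^bold>\<not> \<phi>)"
    using ext by (simp add: extension_of_def)
next
  assume ax: "\<forall>\<phi>. \<turnstile>\<^bsub>L\<^esub> \<^bold>\<not> (\<phi> \<^bold>\<and> \<^bold>\<not> \<phi>)"
  have "\<turnstile>\<^bsub>L\<^esub> \<phi>" if "\<turnstile>\<^bsub>SMTL\<^esub> \<phi>" for \<phi>
    using that
  proof (induction rule: provable.induct)
    case (schema \<alpha> \<sigma>)
    then show ?case
      using ax by (simp add: SMTL_def)
  qed (auto intro: provable.mtl provable.mp)
  then show "extension_of L SMTL"
    by (simp add: extension_of_def)
qed

subsection \<open>Pseudo-relevance yields SMTL\<close>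

lemma contradictions_incompatible:
  "\<turnstile>\<^bsub>L\<^esub> (\<phi> \<^bold>\<and> \<^bold>\<not> \<phi>) \<^bold>\<rightarrow> \<^bold>\<not> (\<psi> \<^bold>\<and> \<^bold>\<not> \<psi>)"
proof -
  let ?a = "\<phi> \<^bold>\<and> \<^bold>\<not> \<phi>" and ?b = "\<psi> \<^bold>\<and> \<^bold>\<not> \<psi>"
  \<comment> \<open>The right conjunct \<open>\<not> \<chi>\<close> refutes the left one, so a
    contradiction implies its own negation.\<close>
  have sq: "\<turnstile>\<^bsub>L\<^esub> (\<chi> \<^bold>\<and> \<^bold>\<not> \<chi>) \<^bold>\<rightarrow> \<^bold>\<not> (\<chi> \<^bold>\<and> \<^bold>\<not> \<chi>)" for \<chi>
    by (rule imp_trans[OF and_imp_right neg_antimono[OF and_imp_left]])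
  \<comment> \<open>If \<open>?b\<close> lies below \<open>?a\<close>, then \<open>?a\<close> yields
    \<open>\<not> ?a\<close>, which lies below \<open>\<not> ?b\<close>.\<close>
  have "\<turnstile>\<^bsub>L\<^esub> (?b \<^bold>\<rightarrow> ?a) \<^bold>\<rightarrow> (\<^bold>\<not> ?a \<^bold>\<rightarrow> \<^bold>\<not> ?b)"
    by (rule contraposition)
  moreover have "\<turnstile>\<^bsub>L\<^esub> (\<^bold>\<not> ?a \<^bold>\<rightarrow> \<^bold>\<not> ?b) \<^bold>\<rightarrow> (?a \<^bold>\<rightarrow> \<^bold>\<not> ?b)"
    by (rule imp_antimono[OF sq])
  ultimately have 1: "\<turnstile>\<^bsub>L\<^esub> (?b \<^bold>\<rightarrow> ?a) \<^bold>\<rightarrow> (?a \<^bold>\<rightarrow> \<^bold>\<not> ?b)"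
    by (rule imp_trans)
  \<comment> \<open>If \<open>?a\<close> lies below \<open>?b\<close>, then \<open>?a\<close> yields
    \<open>?b\<close>, which implies its own negation.\<close>
  have "\<turnstile>\<^bsub>L\<^esub> ?a \<^bold>\<rightarrow> ((?a \<^bold>\<rightarrow> ?b) \<^bold>\<rightarrow> \<^bold>\<not> ?b)"
    unfolding residuation[symmetric] by (rule imp_trans[OF modus_ponens_imp sq])
  then have 2: "\<turnstile>\<^bsub>L\<^esub> (?a \<^bold>\<rightarrow> ?b) \<^bold>\<rightarrow> (?a \<^bold>\<rightarrow> \<^bold>\<not> ?b)"
    by (rule imp_exchange)
  from 2 1 show ?thesis
    by (rule prelinearity)
qed

lemma extension_of_SMTL_if_pseudo_relevance:
  assumes "pseudo_relevance L"
  shows "extension_of L SMTL"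
proof -
  have "vars (Var 0 \<^bold>\<and> \<^bold>\<not> Var 0) \<inter> vars (\<^bold>\<not> (Var 1 \<^bold>\<and> \<^bold>\<not> Var 1)) = {}"
    by simp
  then have "(\<turnstile>\<^bsub>L\<^esub> \<^bold>\<not> (Var 0 \<^bold>\<and> \<^bold>\<not> Var 0)) \<or> (\<turnstile>\<^bsub>L\<^esub> \<^bold>\<not> (Var 1 \<^bold>\<and> \<^bold>\<not> Var 1))"
    using assms[unfolded pseudo_relevance_def, rule_format, OF _ contradictions_incompatible]
    by simp
  then obtain n where n: "\<turnstile>\<^bsub>L\<^esub> \<^bold>\<not> (Var n \<^bold>\<and> \<^bold>\<not> Var n)"
    by auto
  have "\<turnstile>\<^bsub>L\<^esub> \<^bold>\<not> (\<phi> \<^bold>\<and> \<^bold>\<not> \<phi>)" for \<phi>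
    using provable_subst[OF n, of "\<lambda>_. \<phi>"] by simp
  then show ?thesis
    by (simp add: extension_of_SMTL_iff)
qed

subsection \<open>Classical valuations\<close>

primrec eval :: "(nat \<Rightarrow> bool) \<Rightarrow> form \<Rightarrow> bool" where
  "eval v (Var n) = v n"
| "eval v \<^bold>\<bottom> = False"
| "eval v (\<phi> \<^bold>& \<psi>) = (eval v \<phi> \<and> eval v \<psi>)"
| "eval v (\<phi> \<^bold>\<and> \<psi>) = (eval v \<phi> \<and> eval v \<psi>)"
| "eval v (\<phi> \<^bold>\<rightarrow> \<psi>) = (eval v \<phi> \<longrightarrow> eval v \<psi>)"

text \<open>The constants \<open>\<not> \<bottom>\<close> and \<open>\<bottom>\<close> obey the
  classical truth tables in every extension of MTL. Only the values of \<open>\<sigma>\<close> on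
  the variables of \<open>\<phi>\<close> are prescribed, so that \<open>\<sigma>\<close> may fix the
  variables of another formula.\<close>

lemma ground_instance_decided:
  assumes "\<And>n. n \<in> vars \<phi> \<Longrightarrow> \<sigma> n = (if v n then \<^bold>\<not> \<^bold>\<bottom> else \<^bold>\<bottom>)"
  shows "\<turnstile>\<^bsub>L\<^esub> (if eval v \<phi> then subst_form \<sigma> \<phi> else \<^bold>\<not> subst_form \<sigma> \<phi>)"
  using assms
proof (induction \<phi>)
  case (Var n)
  then show ?case
    by (simp add: Neg_def imp_refl)
next
  case Bot
  then show ?case
    by (simp add: Neg_def imp_refl)
next
  case (Strong \<phi> \<psi>)
  let ?a = "subst_form \<sigma> \<phi>" and ?b = "subst_form \<sigma> \<psi>"
  have ih: "\<turnstile>\<^bsub>L\<^esub> (if eval v \<phi> then ?a else \<^bold>\<not> ?a)" "\<turnstile>\<^bsub>L\<^esub> (if eval v \<psi> then ?b else \<^bold>\<not> ?b)"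
    using Strong by simp_all
  have "\<turnstile>\<^bsub>L\<^esub> ?a \<^bold>\<rightarrow> (?b \<^bold>\<rightarrow> ?a \<^bold>& ?b)"
    unfolding residuation[symmetric] by (rule imp_refl)
  then have "\<turnstile>\<^bsub>L\<^esub> ?a \<Longrightarrow> \<turnstile>\<^bsub>L\<^esub> ?b \<Longrightarrow> \<turnstile>\<^bsub>L\<^esub> ?a \<^bold>& ?b"
    using mp by metis
  moreover have "\<turnstile>\<^bsub>L\<^esub> \<^bold>\<not> ?a \<Longrightarrow> \<turnstile>\<^bsub>L\<^esub> \<^bold>\<not> (?a \<^bold>& ?b)"
    by (rule mp[OF _ neg_antimono[OF strong_imp_left]])
  moreover have "\<turnstile>\<^bsub>L\<^esub> \<^bold>\<not> ?b \<Longrightarrow> \<turnstile>\<^bsub>L\<^esub> \<^bold>\<not> (?a \<^bold>& ?b)"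
    by (rule mp[OF _ neg_antimono[OF strong_imp_right]])
  ultimately show ?case
    using ih by (simp split: if_splits)
next
  case (And \<phi> \<psi>)
  let ?a = "subst_form \<sigma> \<phi>" and ?b = "subst_form \<sigma> \<psi>"
  have ih: "\<turnstile>\<^bsub>L\<^esub> (if eval v \<phi> then ?a else \<^bold>\<not> ?a)" "\<turnstile>\<^bsub>L\<^esub> (if eval v \<psi> then ?b else \<^bold>\<not> ?b)"
    using And by simp_all
  have "\<turnstile>\<^bsub>L\<^esub> ?a \<^bold>\<rightarrow> (?b \<^bold>\<rightarrow> ?a \<^bold>\<and> ?b)"
    unfolding residuation[symmetric] by (rule strong_imp_and)
  then have "\<turnstile>\<^bsub>L\<^esub> ?a \<Longrightarrow> \<turnstile>\<^bsub>L\<^esub> ?b \<Longrightarrow> \<turnstile>\<^bsub>L\<^esub> ?a \<^bold>\<and> ?b"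
    using mp by metis
  moreover have "\<turnstile>\<^bsub>L\<^esub> \<^bold>\<not> ?a \<Longrightarrow> \<turnstile>\<^bsub>L\<^esub> \<^bold>\<not> (?a \<^bold>\<and> ?b)"
    by (rule mp[OF _ neg_antimono[OF and_imp_left]])
  moreover have "\<turnstile>\<^bsub>L\<^esub> \<^bold>\<not> ?b \<Longrightarrow> \<turnstile>\<^bsub>L\<^esub> \<^bold>\<not> (?a \<^bold>\<and> ?b)"
    by (rule mp[OF _ neg_antimono[OF and_imp_right]])
  ultimately show ?case
    using ih by (simp split: if_splits)
next
  case (Imp \<phi> \<psi>)
  let ?a = "subst_form \<sigma> \<phi>" and ?b = "subst_form \<sigma> \<psi>"
  have ih: "\<turnstile>\<^bsub>L\<^esub> (if eval v \<phi> then ?a else \<^bold>\<not> ?a)" "\<turnstile>\<^bsub>L\<^esub> (if eval v \<psi> then ?b else \<^bold>\<not> ?b)"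
    using Imp by simp_all
  have "\<turnstile>\<^bsub>L\<^esub> ?a \<^bold>\<rightarrow> (\<^bold>\<not> ?b \<^bold>\<rightarrow> \<^bold>\<not> (?a \<^bold>\<rightarrow> ?b))"
    by (rule imp_trans[OF imp_not_not not_imp])
  then have "\<turnstile>\<^bsub>L\<^esub> ?a \<Longrightarrow> \<turnstile>\<^bsub>L\<^esub> \<^bold>\<not> ?b \<Longrightarrow> \<turnstile>\<^bsub>L\<^esub> \<^bold>\<not> (?a \<^bold>\<rightarrow> ?b)"
    using mp by metis
  moreover have "\<turnstile>\<^bsub>L\<^esub> ?b \<Longrightarrow> \<turnstile>\<^bsub>L\<^esub> ?a \<^bold>\<rightarrow> ?b"
    by (rule imp_of_provable)
  moreover have "\<turnstile>\<^bsub>L\<^esub> \<^bold>\<not> ?a \<Longrightarrow> \<turnstile>\<^bsub>L\<^esub> ?a \<^bold>\<rightarrow> ?b"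
    by (rule mp[OF _ not_imp_imp])
  ultimately show ?case
    using ih by (simp split: if_splits)
qed

lemma conclusion_provable_if_satisfiable:
  assumes disj: "vars \<phi> \<inter> vars \<psi> = {}" and imp: "\<turnstile>\<^bsub>L\<^esub> \<phi> \<^bold>\<rightarrow> \<psi>" and sat: "eval v \<phi>"
  shows "\<turnstile>\<^bsub>L\<^esub> \<psi>"
proof -
  \<comment> \<open>Grounds the variables of \<open>\<phi>\<close> as \<open>v\<close> dictates and
    fixes all others, in particular those of \<open>\<psi>\<close>.\<close>
  define \<sigma> where
    "\<sigma> n = (if n \<in> vars \<phi> then if v n then \<^bold>\<not> \<^bold>\<bottom> else \<^bold>\<bottom> else Var n)" for n
  have "\<turnstile>\<^bsub>L\<^esub> subst_form \<sigma> \<phi>"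
    using ground_instance_decided[of \<phi> \<sigma> v L] sat by (simp add: \<sigma>_def)
  moreover have "subst_form \<sigma> \<psi> = \<psi>"
    using disj by (intro subst_ident) (auto simp: \<sigma>_def)
  moreover have "\<turnstile>\<^bsub>L\<^esub> subst_form \<sigma> \<phi> \<^bold>\<rightarrow> subst_form \<sigma> \<psi>"
    using provable_subst[OF imp, of \<sigma>] by simp
  ultimately show ?thesis
    using mp[of L "subst_form \<sigma> \<phi>" \<psi>] by simp
qed

subsection \<open>Glivenko's theorem over SMTL\<close>

text \<open>Only the contraction half is stated, as the converse implication is an instance of
  \<open>strong_imp_left\<close>. An idempotent antecedent can be used any number of times.\<close>

definition idempotent :: "form set \<Rightarrow> form \<Rightarrow> bool" where
  "idempotent L \<eta> \<longleftrightarrow> (\<turnstile>\<^bsub>L\<^esub> \<eta> \<^bold>\<rightarrow> \<eta> \<^bold>& \<eta>)"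

text \<open>One copy of \<open>\<eta>\<close> feeds each premise. An idempotent antecedent thus acts
  as a classical hypothesis closed under modus ponens.\<close>

lemma idempotent_mp:
  assumes "idempotent L \<eta>" "\<turnstile>\<^bsub>L\<^esub> \<eta> \<^bold>\<rightarrow> \<phi>" "\<turnstile>\<^bsub>L\<^esub> \<eta> \<^bold>\<rightarrow> (\<phi> \<^bold>\<rightarrow> \<psi>)"
  shows "\<turnstile>\<^bsub>L\<^esub> \<eta> \<^bold>\<rightarrow> \<psi>"
  using imp_trans[OF imp_trans[OF assms(1)[unfolded idempotent_def] strong_mono[OF assms(2,3)]]
      modus_ponens_imp] .

lemma idempotent_strong:
  assumes "idempotent L \<eta>" "idempotent L \<theta>"
  shows "idempotent L (\<eta> \<^bold>& \<theta>)"
  using assms unfolding idempotent_def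
  by (rule imp_trans[OF strong_mono strong_interchange])

text \<open>Kalmar's lemma up to double negation, with \<open>\<eta>\<close> encoding the valuation.
  Idempotence enters where the information on two subformulas must be combined.\<close>

lemma idempotent_decides:
  assumes idem: "idempotent L \<eta>"
    and "\<And>n. n \<in> vars \<phi> \<Longrightarrow> \<turnstile>\<^bsub>L\<^esub> \<eta> \<^bold>\<rightarrow> (if v n then \<^bold>\<not> \<^bold>\<not> Var n else \<^bold>\<not> Var n)"
  shows "\<turnstile>\<^bsub>L\<^esub> \<eta> \<^bold>\<rightarrow> (if eval v \<phi> then \<^bold>\<not> \<^bold>\<not> \<phi> else \<^bold>\<not> \<phi>)"
  using assms(2)
proof (induction \<phi>)
  case (Var n)
  then show ?case
    by simp
next
  case Bot
  then show ?case
    by (simp add: Neg_def imp_refl imp_of_provable)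
next
  case (Strong \<phi> \<psi>)
  have ih: "\<turnstile>\<^bsub>L\<^esub> \<eta> \<^bold>\<rightarrow> (if eval v \<phi> then \<^bold>\<not> \<^bold>\<not> \<phi> else \<^bold>\<not> \<phi>)"
    "\<turnstile>\<^bsub>L\<^esub> \<eta> \<^bold>\<rightarrow> (if eval v \<psi> then \<^bold>\<not> \<^bold>\<not> \<psi> else \<^bold>\<not> \<psi>)"
    using Strong by simp_all
  have "\<turnstile>\<^bsub>L\<^esub> \<eta> \<^bold>\<rightarrow> \<^bold>\<not> \<^bold>\<not> (\<phi> \<^bold>& \<psi>)"
    if "\<turnstile>\<^bsub>L\<^esub> \<eta> \<^bold>\<rightarrow> \<^bold>\<not> \<^bold>\<not> \<phi>" "\<turnstile>\<^bsub>L\<^esub> \<eta> \<^bold>\<rightarrow> \<^bold>\<not> \<^bold>\<not> \<psi>"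
    using idempotent_mp[OF idem that(2) imp_trans[OF that(1) not_not_strong]] .
  moreover have "\<turnstile>\<^bsub>L\<^esub> \<eta> \<^bold>\<rightarrow> \<^bold>\<not> (\<phi> \<^bold>& \<psi>)" if "\<turnstile>\<^bsub>L\<^esub> \<eta> \<^bold>\<rightarrow> \<^bold>\<not> \<phi>"
    using that neg_antimono[OF strong_imp_left] by (rule imp_trans)
  moreover have "\<turnstile>\<^bsub>L\<^esub> \<eta> \<^bold>\<rightarrow> \<^bold>\<not> (\<phi> \<^bold>& \<psi>)" if "\<turnstile>\<^bsub>L\<^esub> \<eta> \<^bold>\<rightarrow> \<^bold>\<not> \<psi>"
    using that neg_antimono[OF strong_imp_right] by (rule imp_trans)
  ultimately show ?case
    using ih by (simp split: if_splits)
next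
  case (And \<phi> \<psi>)
  have ih: "\<turnstile>\<^bsub>L\<^esub> \<eta> \<^bold>\<rightarrow> (if eval v \<phi> then \<^bold>\<not> \<^bold>\<not> \<phi> else \<^bold>\<not> \<phi>)"
    "\<turnstile>\<^bsub>L\<^esub> \<eta> \<^bold>\<rightarrow> (if eval v \<psi> then \<^bold>\<not> \<^bold>\<not> \<psi> else \<^bold>\<not> \<psi>)"
    using And by simp_all
  have "\<turnstile>\<^bsub>L\<^esub> \<eta> \<^bold>\<rightarrow> \<^bold>\<not> \<^bold>\<not> (\<phi> \<^bold>\<and> \<psi>)"
    if "\<turnstile>\<^bsub>L\<^esub> \<eta> \<^bold>\<rightarrow> \<^bold>\<not> \<^bold>\<not> \<phi>" "\<turnstile>\<^bsub>L\<^esub> \<eta> \<^bold>\<rightarrow> \<^bold>\<not> \<^bold>\<not> \<psi>"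
    \<comment> \<open>The argument passes through \<open>\<phi> & \<psi>\<close>, which lies below
      \<open>\<phi> \<and> \<psi>\<close>.\<close>
    using idempotent_mp[OF idem that(2) imp_trans[OF that(1) not_not_strong]]
      neg_antimono[OF neg_antimono[OF strong_imp_and]] by (rule imp_trans)
  moreover have "\<turnstile>\<^bsub>L\<^esub> \<eta> \<^bold>\<rightarrow> \<^bold>\<not> (\<phi> \<^bold>\<and> \<psi>)" if "\<turnstile>\<^bsub>L\<^esub> \<eta> \<^bold>\<rightarrow> \<^bold>\<not> \<phi>"
    using that neg_antimono[OF and_imp_left] by (rule imp_trans)
  moreover have "\<turnstile>\<^bsub>L\<^esub> \<eta> \<^bold>\<rightarrow> \<^bold>\<not> (\<phi> \<^bold>\<and> \<psi>)" if "\<turnstile>\<^bsub>L\<^esub> \<eta> \<^bold>\<rightarrow> \<^bold>\<not> \<psi>"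
    using that neg_antimono[OF and_imp_right] by (rule imp_trans)
  ultimately show ?case
    using ih by (simp split: if_splits)
next
  case (Imp \<phi> \<psi>)
  have ih: "\<turnstile>\<^bsub>L\<^esub> \<eta> \<^bold>\<rightarrow> (if eval v \<phi> then \<^bold>\<not> \<^bold>\<not> \<phi> else \<^bold>\<not> \<phi>)"
    "\<turnstile>\<^bsub>L\<^esub> \<eta> \<^bold>\<rightarrow> (if eval v \<psi> then \<^bold>\<not> \<^bold>\<not> \<psi> else \<^bold>\<not> \<psi>)"
    using Imp by simp_all
  have "\<turnstile>\<^bsub>L\<^esub> \<eta> \<^bold>\<rightarrow> \<^bold>\<not> (\<phi> \<^bold>\<rightarrow> \<psi>)"
    if "\<turnstile>\<^bsub>L\<^esub> \<eta> \<^bold>\<rightarrow> \<^bold>\<not> \<^bold>\<not> \<phi>" "\<turnstile>\<^bsub>L\<^esub> \<eta> \<^bold>\<rightarrow> \<^bold>\<not> \<psi>"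
    using idempotent_mp[OF idem that(2) imp_trans[OF that(1) not_imp]] .
  moreover have "\<turnstile>\<^bsub>L\<^esub> \<eta> \<^bold>\<rightarrow> \<^bold>\<not> \<^bold>\<not> (\<phi> \<^bold>\<rightarrow> \<psi>)" if "\<turnstile>\<^bsub>L\<^esub> \<eta> \<^bold>\<rightarrow> \<^bold>\<not> \<phi>"
    using that imp_trans[OF not_imp_imp imp_not_not] by (rule imp_trans)
  moreover have "\<turnstile>\<^bsub>L\<^esub> \<eta> \<^bold>\<rightarrow> \<^bold>\<not> \<^bold>\<not> (\<phi> \<^bold>\<rightarrow> \<psi>)" if "\<turnstile>\<^bsub>L\<^esub> \<eta> \<^bold>\<rightarrow> \<^bold>\<not> \<^bold>\<not> \<psi>"
    using that neg_antimono[OF neg_antimono[OF imp_weaken]] by (rule imp_trans)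
  ultimately show ?case
    using ih by (simp split: if_splits)
qed

text \<open>Divisibility turns each antecedent, multiplied by its own premise, into a contradiction
  that SMTL refutes. Together they convert the two prelinearity alternatives for
  \<open>\<phi>\<close> and \<open>\<not> \<phi>\<close> into \<open>\<not> \<phi>\<close> and
  \<open>\<not> \<not> \<phi>\<close>.\<close>

lemma SMTL_imp_not:
  assumes "extension_of L SMTL"
  shows "\<turnstile>\<^bsub>L\<^esub> (\<phi> \<^bold>\<rightarrow> \<^bold>\<not> \<phi>) \<^bold>\<rightarrow> \<^bold>\<not> \<phi>" "\<turnstile>\<^bsub>L\<^esub> (\<^bold>\<not> \<phi> \<^bold>\<rightarrow> \<phi>) \<^bold>\<rightarrow> \<^bold>\<not> \<^bold>\<not> \<phi>"
proof -
  have bot: "\<turnstile>\<^bsub>L\<^esub> \<phi> \<^bold>\<and> \<^bold>\<not> \<phi> \<^bold>\<rightarrow> \<^bold>\<bottom>"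
    using assms by (simp add: extension_of_SMTL_iff flip: Neg_def)
  have "\<turnstile>\<^bsub>L\<^esub> \<phi> \<^bold>& (\<phi> \<^bold>\<rightarrow> \<^bold>\<not> \<phi>) \<^bold>\<rightarrow> \<^bold>\<bottom>"
    using imp_trans[OF imp_trans[OF divisibility mtl[OF MTL_axiom.intros(5)]] bot] .
  then show "\<turnstile>\<^bsub>L\<^esub> (\<phi> \<^bold>\<rightarrow> \<^bold>\<not> \<phi>) \<^bold>\<rightarrow> \<^bold>\<not> \<phi>"
    unfolding neg_imp_residuation[symmetric] by (rule imp_trans[OF strong_commute])
  have "\<turnstile>\<^bsub>L\<^esub> \<^bold>\<not> \<phi> \<^bold>& (\<^bold>\<not> \<phi> \<^bold>\<rightarrow> \<phi>) \<^bold>\<rightarrow> \<^bold>\<bottom>"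
    using imp_trans[OF divisibility bot] .
  then show "\<turnstile>\<^bsub>L\<^esub> (\<^bold>\<not> \<phi> \<^bold>\<rightarrow> \<phi>) \<^bold>\<rightarrow> \<^bold>\<not> \<^bold>\<not> \<phi>"
    unfolding neg_imp_residuation[symmetric] by (rule imp_trans[OF strong_commute])
qed

text \<open>Prelinearity for \<open>\<not> \<phi>\<close> and \<open>\<not> \<not> \<phi>\<close>:
  one alternative gives \<open>\<not> \<not> \<phi>\<close>, from which \<open>\<not> \<phi>\<close>
  implies anything; the other gives \<open>\<not> \<phi>\<close> itself, which supplies the second
  factor.\<close>

lemma SMTL_idempotent_neg:
  assumes ext: "extension_of L SMTL"
  shows "idempotent L (\<^bold>\<not> \<phi>)"
proof -
  have "\<turnstile>\<^bsub>L\<^esub> (\<^bold>\<not> \<phi> \<^bold>\<rightarrow> \<^bold>\<not> \<^bold>\<not> \<phi>) \<^bold>\<rightarrow> (\<^bold>\<not> \<phi> \<^bold>\<rightarrow> \<^bold>\<not> \<phi> \<^bold>& \<^bold>\<not> \<phi>)"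
    using SMTL_imp_not(1)[OF ext] not_imp_imp by (rule imp_trans)
  moreover have "\<turnstile>\<^bsub>L\<^esub> \<^bold>\<not> \<phi> \<^bold>\<rightarrow> (\<^bold>\<not> \<phi> \<^bold>\<rightarrow> \<^bold>\<not> \<phi> \<^bold>& \<^bold>\<not> \<phi>)"
    unfolding residuation[symmetric] by (rule imp_refl)
  then have "\<turnstile>\<^bsub>L\<^esub> (\<^bold>\<not> \<^bold>\<not> \<phi> \<^bold>\<rightarrow> \<^bold>\<not> \<phi>) \<^bold>\<rightarrow> (\<^bold>\<not> \<phi> \<^bold>\<rightarrow> \<^bold>\<not> \<phi> \<^bold>& \<^bold>\<not> \<phi>)"
    by (rule imp_trans[OF imp_trans[OF SMTL_imp_not(2)[OF ext] not_not_not_imp]])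
  ultimately show ?thesis
    unfolding idempotent_def by (rule prelinearity)
qed

text \<open>Weak excluded middle as an elimination rule, from prelinearity for \<open>\<phi>\<close>
  and \<open>\<not> \<phi>\<close>.\<close>

lemma SMTL_cases:
  assumes ext: "extension_of L SMTL"
    and "\<turnstile>\<^bsub>L\<^esub> \<^bold>\<not> \<phi> \<^bold>\<rightarrow> \<chi>" "\<turnstile>\<^bsub>L\<^esub> \<^bold>\<not> \<^bold>\<not> \<phi> \<^bold>\<rightarrow> \<chi>"
  shows "\<turnstile>\<^bsub>L\<^esub> \<chi>"
  using imp_trans[OF SMTL_imp_not(1)[OF ext] assms(2)]
    imp_trans[OF SMTL_imp_not(2)[OF ext] assms(3)] by (rule prelinearity)

text \<open>\<open>W\<close> contains the variables that \<open>\<eta>\<close> need not yet decide.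
  The induction removes one at a time, multiplying \<open>\<eta>\<close> by either of its literals;
  once none is left, \<open>\<eta>\<close> encodes a valuation, which falsifies
  \<open>\<phi>\<close>.\<close>

lemma idempotent_imp_neg:
  assumes ext: "extension_of L SMTL" and unsat: "\<And>v. \<not> eval v \<phi>"
    and "finite W" "idempotent L \<eta>"
    and "\<And>n. n \<in> vars \<phi> - W \<Longrightarrow> (\<turnstile>\<^bsub>L\<^esub> \<eta> \<^bold>\<rightarrow> \<^bold>\<not> Var n) \<or> (\<turnstile>\<^bsub>L\<^esub> \<eta> \<^bold>\<rightarrow> \<^bold>\<not> \<^bold>\<not> Var n)"
  shows "\<turnstile>\<^bsub>L\<^esub> \<eta> \<^bold>\<rightarrow> \<^bold>\<not> \<phi>"
  using assms(3-)
proof (induction W arbitrary: \<eta> rule: finite_induct)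
  case empty
  \<comment> \<open>Where \<open>\<eta>\<close> does not imply \<open>\<not> \<not> Var n\<close>,
    the hypothesis leaves \<open>\<not> Var n\<close> for the variables of
    \<open>\<phi>\<close>.\<close>
  define v where "v n \<longleftrightarrow> (\<turnstile>\<^bsub>L\<^esub> \<eta> \<^bold>\<rightarrow> \<^bold>\<not> \<^bold>\<not> Var n)" for n
  have "\<turnstile>\<^bsub>L\<^esub> \<eta> \<^bold>\<rightarrow> (if v n then \<^bold>\<not> \<^bold>\<not> Var n else \<^bold>\<not> Var n)" if "n \<in> vars \<phi>" for n
    using empty.prems(2)[of n] that by (auto simp: v_def)
  then show ?case
    using idempotent_decides[of L \<eta> \<phi> v] empty.prems(1) unsat[of v] by simp
next
  case (insert m W)
  \<comment> \<open>The literal is kept as a separate antecedent so that \<open>SMTL_cases\<close>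
    can eliminate it and leave the original \<open>\<eta>\<close>.\<close>
  have branch: "\<turnstile>\<^bsub>L\<^esub> \<theta> \<^bold>\<rightarrow> (\<eta> \<^bold>\<rightarrow> \<^bold>\<not> \<phi>)"
    if \<theta>: "\<theta> = \<^bold>\<not> Var m \<or> \<theta> = \<^bold>\<not> \<^bold>\<not> Var m" for \<theta>
  proof -
    have "idempotent L \<theta>"
      using \<theta> SMTL_idempotent_neg[OF ext] by blast
    then have "idempotent L (\<theta> \<^bold>& \<eta>)"
      using insert.prems(1) by (rule idempotent_strong)
    moreover have "(\<turnstile>\<^bsub>L\<^esub> \<theta> \<^bold>& \<eta> \<^bold>\<rightarrow> \<^bold>\<not> Var n) \<or> (\<turnstile>\<^bsub>L\<^esub> \<theta> \<^bold>& \<eta> \<^bold>\<rightarrow> \<^bold>\<not> \<^bold>\<not> Var n)"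
      if "n \<in> vars \<phi> - W" for n
    proof (cases "n = m")
      case True
      then show ?thesis
        using \<theta> strong_imp_left by blast
    next
      case False
      then show ?thesis
        using insert.prems(2)[of n] that imp_trans[OF strong_imp_right] by blast
    qed
    ultimately have "\<turnstile>\<^bsub>L\<^esub> \<theta> \<^bold>& \<eta> \<^bold>\<rightarrow> \<^bold>\<not> \<phi>"
      by (rule insert.IH)
    then show ?thesis
      by (simp add: residuation)
  qed
  show ?case
    using SMTL_cases[OF ext branch branch] by blast
qed

lemma neg_provable_if_unsatisfiable:
  assumes ext: "extension_of L SMTL" and unsat: "\<And>v. \<not> eval v \<phi>"
  shows "\<turnstile>\<^bsub>L\<^esub> \<^bold>\<not> \<phi>"
proof -
  \<comment> \<open>Starts from a provable negation, idempotent like every negation over SMTL, with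
    all variables of \<open>\<phi>\<close> undecided.\<close>
  have "\<turnstile>\<^bsub>L\<^esub> \<^bold>\<not> \<^bold>\<bottom> \<^bold>\<rightarrow> \<^bold>\<not> \<phi>"
    by (rule idempotent_imp_neg[OF ext unsat finite_vars[of \<phi>] SMTL_idempotent_neg[OF ext]]) simp
  then show ?thesis
    using mp[OF imp_refl] unfolding Neg_def by blast
qed

theorem theorem3p14:
  fixes L :: "form set"
  shows "pseudo_relevance L \<longleftrightarrow> extension_of L SMTL"
proof
  assume "pseudo_relevance L"
  then show "extension_of L SMTL"
    by (rule extension_of_SMTL_if_pseudo_relevance)
next
  assume ext: "extension_of L SMTL"
  show "pseudo_relevance L"
    unfolding pseudo_relevance_def
    \<comment> \<open>The case split is on whether some classical valuation satisfies the
      antecedent.\<close>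
    using neg_provable_if_unsatisfiable[OF ext] conclusion_provable_if_satisfiable by blast
qed

end
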